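(* Let $r,d,q$ be positive integers. Every sequence of $n\ge(\lceil q/r\rceil+2)(2rd+1)^d$ elements of $[-r,r]^d$ whose sum lies in $[-q,q]^d$ contains a nonempty proper subsequence whose sum is the zero vector.
   Context: $[-r,r]^d$ denotes the set of $d$-dimensional integer vectors all of whose coordinates lie in $\{-r,\ldots,r\}$; similarly $[-q,q]^d$. A subsequence is a sub-multiset of the terms (indexed by a subset of positions); proper means not all terms. *)

theory Defs
  imports "HOL-Analysis.Analysis"
begin

definition int_box :: "nat \<Rightarrow> (int ^ 'd) set" where
  "int_box r = {v. \<forall>i. v $ i \<in> {- int r..int r}}"

end

theory Submission
  imports Defs
begin

text \<open>
  Write the negated sum of the sequence as a sum of $m$ auxiliary vectors of the box
  $[-r,r]^d$ and append them, so that the total becomes zero. By the Steinitz lemma (with the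
  constant $d$ of Grinberg and Sevastyanov) the terms can be ordered so that all partial sums
  lie in $[-rd,rd]^d$. By the pigeonhole principle two partial sums agree that moreover involve
  the same number of auxiliary vectors; the block between them consists of original terms and
  sums to zero. The block is proper when the total sum $s$ is nonzero, where
  $m = \lceil q/r \rceil$ works; when $s = 0$ one drops a term and takes $m = 1$.
\<close>

section \<open>Affine relations and weightings with few fractional entries\<close>

text \<open>The library result concerns sets of vectors, but the terms of a sequence may repeat. If
  \<open>v\<close> is injective on \<open>F\<close> the result transfers to the indices; otherwise
  two indices with equal vectors, weighted 1 and -1, already give a relation.\<close>

lemma affine_dependent_family:
  fixes v :: "'b \<Rightarrow> 'a::euclidean_space"
  assumes "finite F" and "card F \<ge> DIM('a) + 2"
  obtains \<mu> :: "'b \<Rightarrow> real" where "\<exists>i\<in>F. \<mu> i \<noteq> 0" and "(\<Sum>i\<in>F. \<mu> i) = 0"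
    and "(\<Sum>i\<in>F. \<mu> i *\<^sub>R v i) = 0"
proof (cases "inj_on v F")
  case True
  then have "affine_dependent (v ` F)"
    using assms by (intro affine_dependent_biggerset) (auto simp: card_image)
  then obtain U where U: "sum U (v ` F) = 0" "\<exists>w\<in>v ` F. U w \<noteq> 0"
      "(\<Sum>w\<in>v ` F. U w *\<^sub>R w) = 0"
    using assms(1) by (auto simp: affine_dependent_explicit_finite)
  show ?thesis
    using U True by (intro that[of "\<lambda>i. U (v i)"]) (auto simp: sum.reindex)
next
  case False
  then obtain i j where ij: "i \<in> F" "j \<in> F" "i \<noteq> j" "v i = v j"
    by (auto simp: inj_on_def)
  let ?\<mu> = "\<lambda>k. (if k = i then 1 else 0) - (if k = j then 1 else (0::real))"
  have "(\<Sum>k\<in>F. ?\<mu> k) = 0"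
    using ij assms(1) by (simp add: sum_subtractf)
  moreover have "(\<Sum>k\<in>F. ?\<mu> k *\<^sub>R v k) = 0"
    using ij assms(1)
    by (simp add: scaleR_left_diff_distrib sum_subtractf if_distrib[of "\<lambda>t. t *\<^sub>R _"] cong: if_cong)
  ultimately show ?thesis
    using ij by (intro that[of ?\<mu>]) auto
qed

text \<open>These weights form a polytope: the slice of the unit cube on \<open>A\<close> cut out by
  \<open>DIM('a) + 1\<close> scalar linear equations.\<close>

definition weighting :: "('b \<Rightarrow> 'a::real_vector) \<Rightarrow> 'b set \<Rightarrow> real \<Rightarrow> ('b \<Rightarrow> real) \<Rightarrow> bool" where
  "weighting v A c \<alpha> \<longleftrightarrow>
     (\<forall>i\<in>A. 0 \<le> \<alpha> i \<and> \<alpha> i \<le> 1) \<and> sum \<alpha> A = c \<and> (\<Sum>i\<in>A. \<alpha> i *\<^sub>R v i) = 0"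

text \<open>An affine relation among the vectors with fractional weight gives a direction along
  which both equations of a weighting are preserved. Moving that way until some weight first reaches
  0 or 1 makes it integral, while integral weights stay fixed.\<close>

lemma weighting_fewer_fractional:
  fixes v :: "'b \<Rightarrow> 'a::euclidean_space"
  assumes A: "finite A" and l: "weighting v A c \<alpha>"
    and big: "card {i\<in>A. 0 < \<alpha> i \<and> \<alpha> i < 1} \<ge> DIM('a) + 2"
  obtains \<beta> where "weighting v A c \<beta>"
    and "card {i\<in>A. 0 < \<beta> i \<and> \<beta> i < 1} < card {i\<in>A. 0 < \<alpha> i \<and> \<alpha> i < 1}"
proof -
  define F where "F = {i\<in>A. 0 < \<alpha> i \<and> \<alpha> i < 1}"
  have F: "finite F" "F \<subseteq> A" using A by (auto simp: F_def)
  obtain \<mu> where \<mu>: "\<exists>i\<in>F. \<mu> i \<noteq> 0" "(\<Sum>i\<in>F. \<mu> i) = 0" "(\<Sum>i\<in>F. \<mu> i *\<^sub>R v i) = 0"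
    using affine_dependent_family[of F v] big F by (auto simp: F_def)
  define G where "G = {i\<in>F. \<mu> i \<noteq> 0}"
  \<comment> \<open>\<open>g i\<close> is the step length at which
    \<open>\<alpha> i + t * \<mu> i\<close> reaches 1 or 0, depending on the sign of
    \<open>\<mu> i\<close>. The least of these is the longest step that keeps every weight between 0
    and 1.\<close>
  define g where "g i = (if \<mu> i > 0 then (1 - \<alpha> i) / \<mu> i else \<alpha> i / (- \<mu> i))" for i
  define t where "t = Min (g ` G)"
  have G: "finite G" "G \<noteq> {}" using F \<mu> by (auto simp: G_def)
  have gpos: "g i > 0" if "i \<in> G" for i
    using that by (auto simp: g_def G_def F_def divide_pos_neg)
  have tpos: "t > 0" unfolding t_def using G gpos by simp
  have tle: "t \<le> g i" if "i \<in> G" for i unfolding t_def using G that by simp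
  obtain j where j: "j \<in> G" "t = g j"
    unfolding t_def using G by (metis (no_types, lifting) Min_in finite_imageI image_is_empty imageE)
  define \<beta> where "\<beta> i = (if i \<in> F then \<alpha> i + t * \<mu> i else \<alpha> i)" for i
  have bounds: "0 \<le> \<beta> i \<and> \<beta> i \<le> 1" if "i \<in> A" for i
  proof (cases "i \<in> G")
    case True
    then have iF: "i \<in> F" "0 < \<alpha> i" "\<alpha> i < 1" "\<mu> i \<noteq> 0" by (auto simp: G_def F_def)
    show ?thesis
    proof (cases "\<mu> i > 0")
      case True
      then have "t * \<mu> i \<le> 1 - \<alpha> i"
        using tle[OF \<open>i \<in> G\<close>] by (simp add: g_def field_simps)
      moreover have "t * \<mu> i \<ge> 0" using True tpos by simp
      ultimately show ?thesis using iF by (simp add: \<beta>_def)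
    next
      case False
      then have neg: "\<mu> i < 0" using iF by simp
      then have "- (t * \<mu> i) \<le> \<alpha> i"
        using tle[OF \<open>i \<in> G\<close>] by (simp add: g_def field_simps)
      moreover have "t * \<mu> i \<le> 0" using neg tpos by (simp add: mult_nonneg_nonpos)
      ultimately show ?thesis using iF by (simp add: \<beta>_def)
    qed
  next
    case False
    then have "\<beta> i = \<alpha> i" by (auto simp: G_def \<beta>_def)
    then show ?thesis using l that by (auto simp: weighting_def)
  qed
  have split: "\<beta> i = \<alpha> i + (if i \<in> F then t * \<mu> i else 0)" for i
    by (simp add: \<beta>_def)
  have s1: "sum \<beta> A = c"
  proof -
    have "sum \<beta> A = sum \<alpha> A + (\<Sum>i\<in>F. t * \<mu> i)"
      using A F by (simp add: split sum.distrib sum.If_cases Int_absorb1)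
    then show ?thesis using l \<mu> by (simp add: weighting_def flip: sum_distrib_left)
  qed
  have s2: "(\<Sum>i\<in>A. \<beta> i *\<^sub>R v i) = 0"
  proof -
    have "\<beta> i *\<^sub>R v i = \<alpha> i *\<^sub>R v i + (if i \<in> F then t *\<^sub>R (\<mu> i *\<^sub>R v i) else 0)" for i
      by (simp add: split scaleR_left_distrib)
    then have "(\<Sum>i\<in>A. \<beta> i *\<^sub>R v i) = (\<Sum>i\<in>A. \<alpha> i *\<^sub>R v i) + t *\<^sub>R (\<Sum>i\<in>F. \<mu> i *\<^sub>R v i)"
      using A F by (simp add: sum.distrib sum.If_cases Int_absorb1 scaleR_sum_right)
    then show ?thesis using l \<mu> by (simp add: weighting_def)
  qed
  \<comment> \<open>The index attaining the minimum leaves the fractional set, and no new index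
    enters it.\<close>
  have "\<beta> j = 0 \<or> \<beta> j = 1"
    using j by (auto simp: \<beta>_def g_def G_def)
  moreover have "j \<in> F" using j by (simp add: G_def)
  moreover have "{i\<in>A. 0 < \<beta> i \<and> \<beta> i < 1} \<subseteq> F"
    by (auto simp: \<beta>_def F_def)
  ultimately have "{i\<in>A. 0 < \<beta> i \<and> \<beta> i < 1} \<subset> F"
    by force
  then have "card {i\<in>A. 0 < \<beta> i \<and> \<beta> i < 1} < card F"
    using F by (simp add: psubset_card_mono)
  then show ?thesis
    using that[of \<beta>] bounds s1 s2 by (auto simp: weighting_def F_def)
qed

lemma weighting_few_fractional:
  fixes v :: "'b \<Rightarrow> 'a::euclidean_space"
  assumes "finite A" and "weighting v A c \<alpha>"
  shows "\<exists>\<beta>. weighting v A c \<beta> \<and> card {i\<in>A. 0 < \<beta> i \<and> \<beta> i < 1} \<le> DIM('a) + 1"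
  using assms(2)
proof (induction "card {i\<in>A. 0 < \<alpha> i \<and> \<alpha> i < 1}" arbitrary: \<alpha> rule: less_induct)
  case less
  show ?case
  proof (cases "card {i\<in>A. 0 < \<alpha> i \<and> \<alpha> i < 1} \<le> DIM('a) + 1")
    case True
    then show ?thesis using less.prems by blast
  next
    case False
    then obtain \<beta> where "weighting v A c \<beta>"
      "card {i\<in>A. 0 < \<beta> i \<and> \<beta> i < 1} < card {i\<in>A. 0 < \<alpha> i \<and> \<alpha> i < 1}"
      using weighting_fewer_fractional[OF assms(1) less.prems] by auto
    then show ?thesis using less.hyps by blast
  qed
qed

section \<open>The Steinitz lemma with constant equal to the dimension\<close>

text \<open>This is the invariant kept while indices are removed one at a time. The total
  \<open>card A - DIM('a)\<close> is chosen so that the complementary weights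
  \<open>1 - \<alpha> i\<close> have total exactly \<open>DIM('a)\<close>, whatever the size of
  \<open>A\<close>.\<close>

definition steinitz_set :: "('b \<Rightarrow> 'a::euclidean_space) \<Rightarrow> 'b set \<Rightarrow> bool" where
  "steinitz_set v A \<longleftrightarrow>
     card A \<le> DIM('a) \<or> (\<exists>\<alpha>. weighting v A (real (card A) - real DIM('a)) \<alpha>)"

lemma steinitz_set_remove:
  fixes v :: "'b \<Rightarrow> 'a::euclidean_space"
  assumes A: "finite A" "A \<noteq> {}" and st: "steinitz_set v A"
  shows "\<exists>a\<in>A. steinitz_set v (A - {a})"
proof (cases "card A \<le> DIM('a) + 1")
  case True
  then show ?thesis using A by (auto simp: steinitz_set_def)
next
  case False
  define k where "k = real (card A) - real DIM('a)"
  have k: "k \<ge> 2" using False by (simp add: k_def)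
  obtain \<alpha> where \<alpha>: "weighting v A k \<alpha>"
    using st False by (auto simp: steinitz_set_def k_def)
  define \<kappa> where "\<kappa> i = (k - 1) / k * \<alpha> i" for i
  have "weighting v A (k - 1) \<kappa>"
  proof -
    have "0 \<le> \<kappa> i \<and> \<kappa> i \<le> 1" if "i \<in> A" for i
    proof -
      have "0 \<le> \<alpha> i" "\<alpha> i \<le> 1" using \<alpha> that by (auto simp: weighting_def)
      moreover have "0 \<le> (k - 1) / k" "(k - 1) / k \<le> 1" using k by auto
      ultimately show ?thesis unfolding \<kappa>_def by (simp add: mult_le_one del: times_divide_eq_left)
    qed
    moreover have "sum \<kappa> A = k - 1"
      using \<alpha> k unfolding \<kappa>_def sum_distrib_left[symmetric] by (simp add: weighting_def)
    moreover have "(\<Sum>i\<in>A. \<kappa> i *\<^sub>R v i) = 0"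
      using \<alpha> unfolding \<kappa>_def scaleR_scaleR[symmetric] scaleR_sum_right[symmetric]
      by (simp add: weighting_def)
    ultimately show ?thesis by (simp add: weighting_def)
  qed
  then obtain \<beta> where l': "weighting v A (k - 1) \<beta>"
      and few: "card {i\<in>A. 0 < \<beta> i \<and> \<beta> i < 1} \<le> DIM('a) + 1"
    using weighting_few_fractional[OF A(1)] by blast
  define F where "F = {i\<in>A. 0 < \<beta> i \<and> \<beta> i < 1}"
  have F: "finite F" "F \<subseteq> A" using A by (auto simp: F_def)
  \<comment> \<open>Without a zero weight, every weight outside \<open>F\<close> is 1, so the
    weights on \<open>F\<close> sum to \<open>card F - DIM('a) - 1\<close>. This is at most 0, and
    negative if \<open>F\<close> is empty, whereas the sum is positive or empty.\<close>
  have "\<exists>a\<in>A. \<beta> a = 0"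
  proof (rule ccontr)
    assume "\<not> ?thesis"
    then have one: "\<beta> i = 1" if "i \<in> A - F" for i
      using that l' by (force simp: weighting_def F_def)
    have "k - 1 = (\<Sum>i\<in>A - F. \<beta> i) + (\<Sum>i\<in>F. \<beta> i)"
      using l' A F by (simp add: weighting_def sum.subset_diff)
    also have "(\<Sum>i\<in>A - F. \<beta> i) = real (card A) - real (card F)"
      using one A F by (simp add: card_Diff_subset of_nat_diff card_mono)
    finally have eq: "real (card F) - real DIM('a) - 1 = (\<Sum>i\<in>F. \<beta> i)"
      by (simp add: k_def)
    show False
    proof (cases "F = {}")
      case True
      then show False using eq by simp
    next
      case False
      then have "(\<Sum>i\<in>F. \<beta> i) > 0"
        using F by (intro sum_pos) (auto simp: F_def)
      then show False using eq few by (simp add: F_def)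
    qed
  qed
  then obtain a where a: "a \<in> A" "\<beta> a = 0" by blast
  have "weighting v (A - {a}) (real (card (A - {a})) - real DIM('a)) \<beta>"
    using l' a A False by (simp add: weighting_def sum_diff1 k_def of_nat_diff)
  then show ?thesis using a by (auto simp: steinitz_set_def)
qed

text \<open>After division by \<open>c\<close> the weights total at most 1; giving the missing mass
  to the point 0 of \<open>B\<close> yields a convex combination.\<close>

lemma convex_sum_weights:
  fixes B :: "'a::real_vector set"
  assumes B: "convex B" "0 \<in> B" and A: "finite A" and v: "\<And>i. i \<in> A \<Longrightarrow> v i \<in> B"
    and w: "\<And>i. i \<in> A \<Longrightarrow> 0 \<le> w i" and "sum w A \<le> c" and "c > 0"
  shows "(\<Sum>i\<in>A. w i *\<^sub>R v i) \<in> (*\<^sub>R) c ` B"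
proof -
  \<comment> \<open>The extra index \<open>None\<close> carries the point 0 and the missing
    mass.\<close>
  define u where "u i = (case i of None \<Rightarrow> (c - sum w A) / c | Some i \<Rightarrow> w i / c)" for i
  define z where "z i = (case i of None \<Rightarrow> 0 | Some i \<Rightarrow> v i)" for i
  have sums: "(\<Sum>i\<in>insert None (Some ` A). f i) = f None + (\<Sum>i\<in>A. f (Some i))"
    for f :: "'b option \<Rightarrow> 'c::comm_monoid_add"
    using A by (simp add: sum.reindex)
  have "(\<Sum>i\<in>insert None (Some ` A). u i *\<^sub>R z i) \<in> B"
  proof (rule convex_sum[OF _ B(1)])
    show "sum u (insert None (Some ` A)) = 1"
      unfolding sums using assms(7) by (simp add: u_def flip: sum_divide_distrib add_divide_distrib)
  qed (use A B v w assms(6,7) in \<open>auto simp: u_def z_def\<close>)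
  then have "(\<Sum>i\<in>A. (w i / c) *\<^sub>R v i) \<in> B"
    unfolding sums by (simp add: u_def z_def)
  moreover have "(\<Sum>i\<in>A. w i *\<^sub>R v i) = c *\<^sub>R (\<Sum>i\<in>A. (w i / c) *\<^sub>R v i)"
    using assms(7) by (simp add: scaleR_sum_right)
  ultimately show ?thesis by blast
qed

text \<open>The \<open>\<alpha>\<close>-weighted sum vanishes, so the weights
  \<open>1 - \<alpha> i\<close> give the same vector as the plain sum, with total only
  \<open>DIM('a)\<close>. For small sets the weights 1 suffice.\<close>

lemma steinitz_set_sum:
  fixes v :: "'b \<Rightarrow> 'a::euclidean_space"
  assumes A: "finite A" and "steinitz_set v A" and B: "convex B" "0 \<in> B"
    and v: "\<And>i. i \<in> A \<Longrightarrow> v i \<in> B"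
  shows "sum v A \<in> (*\<^sub>R) (real DIM('a)) ` B"
proof -
  have "\<exists>w. (\<forall>i\<in>A. 0 \<le> w i) \<and> sum w A \<le> real DIM('a) \<and> sum v A = (\<Sum>i\<in>A. w i *\<^sub>R v i)"
  proof (cases "card A \<le> DIM('a)")
    case True
    then show ?thesis by (intro exI[of _ "\<lambda>_. 1"]) simp
  next
    case False
    then obtain \<alpha> where "weighting v A (real (card A) - real DIM('a)) \<alpha>"
      using assms(2) by (auto simp: steinitz_set_def)
    then show ?thesis
      by (intro exI[of _ "\<lambda>i. 1 - \<alpha> i"])
        (auto simp: weighting_def sum_subtractf scaleR_left_diff_distrib)
  qed
  then obtain w where "\<forall>i\<in>A. 0 \<le> w i" "sum w A \<le> real DIM('a)"
      "sum v A = (\<Sum>i\<in>A. w i *\<^sub>R v i)" by blast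
  then show ?thesis
    using convex_sum_weights[OF B A v, where w = w and c = "real DIM('a)"] by simp
qed

text \<open>The chain is built from the top: the removed index becomes the last term of the
  reordering.\<close>

lemma steinitz_set_chain:
  fixes v :: "'b \<Rightarrow> 'a::euclidean_space"
  assumes "finite I" and "steinitz_set v I"
  shows "\<exists>A. mono A \<and> (\<forall>k\<le>card I. A k \<subseteq> I \<and> card (A k) = k \<and> steinitz_set v (A k))"
  using assms
proof (induction "card I" arbitrary: I)
  case 0
  then show ?case by (intro exI[of _ "\<lambda>_. {}"]) (auto simp: mono_def)
next
  case (Suc N)
  then obtain a where a: "a \<in> I" "steinitz_set v (I - {a})"
    using steinitz_set_remove[of I v] by fastforce
  have N: "N = card (I - {a})" using Suc a by simp
  obtain A where A: "mono A"
      "\<forall>k\<le>N. A k \<subseteq> I - {a} \<and> card (A k) = k \<and> steinitz_set v (A k)"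
    using Suc.hyps(1)[OF N] Suc.prems a N by auto
  \<comment> \<open>Keeping the value \<open>I\<close> for all larger \<open>k\<close> makes the
    chain monotone on all of the naturals.\<close>
  define A' where "A' k = (if k \<le> N then A k else I)" for k
  have "mono A'"
    using A by (auto simp: A'_def mono_def)
  moreover have "\<forall>k\<le>card I. A' k \<subseteq> I \<and> card (A' k) = k \<and> steinitz_set v (A' k)"
    using A Suc.hyps(2) Suc.prems by (auto simp: A'_def le_Suc_eq)
  ultimately show ?case by blast
qed

text \<open>The chain of sets encodes the reordering: \<open>A k\<close> is the set of its first \<open>k\<close> terms.\<close>

theorem steinitz_chain:
  fixes v :: "'b \<Rightarrow> 'a::euclidean_space"
  assumes I: "finite I" and B: "convex B" "0 \<in> B" and v: "\<And>i. i \<in> I \<Longrightarrow> v i \<in> B"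
    and sum0: "sum v I = 0"
  obtains A where "mono A" and "\<And>k. k \<le> card I \<Longrightarrow> A k \<subseteq> I"
    and "\<And>k. k \<le> card I \<Longrightarrow> card (A k) = k"
    and "\<And>k. k \<le> card I \<Longrightarrow> sum v (A k) \<in> (*\<^sub>R) (real DIM('a)) ` B"
proof -
  have "steinitz_set v I"
  proof (cases "card I \<le> DIM('a)")
    case False
    \<comment> \<open>Equal weights work for the whole set because its vectors sum to 0.\<close>
    define c where "c = (real (card I) - real DIM('a)) / real (card I)"
    have "weighting v I (real (card I) - real DIM('a)) (\<lambda>_. c)"
      using False sum0 by (auto simp: weighting_def c_def simp flip: scaleR_sum_right)
    then show ?thesis by (auto simp: steinitz_set_def)
  qed (simp add: steinitz_set_def)
  then obtain A where A: "mono A"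
      "\<forall>k\<le>card I. A k \<subseteq> I \<and> card (A k) = k \<and> steinitz_set v (A k)"
    using steinitz_set_chain[OF I] by blast
  show ?thesis
  proof (rule that[of A])
    show "sum v (A k) \<in> (*\<^sub>R) (real DIM('a)) ` B" if "k \<le> card I" for k
      using A that I B v by (intro steinitz_set_sum) (auto intro: finite_subset)
  qed (use A in auto)
qed

section \<open>Integer boxes: counting, reordering and splitting\<close>

lemma finite_card_int_box:
  "finite (int_box r :: (int ^ 'd) set)"
  "card (int_box r :: (int ^ 'd) set) = (2 * r + 1) ^ CARD('d)"
proof -
  let ?P = "Pi\<^sub>E (UNIV :: 'd set) (\<lambda>_. {- int r..int r})"
  have eq: "(int_box r :: (int ^ 'd) set) = vec_lambda ` ?P"
  proof -
    have "v \<in> vec_lambda ` ?P" if "v \<in> int_box r" for v :: "int ^ 'd"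
      using that by (intro image_eqI[of _ _ "vec_nth v"]) (auto simp: int_box_def)
    then show ?thesis by (auto simp: int_box_def PiE_def Pi_def)
  qed
  have inj: "inj_on vec_lambda ?P" by (auto simp: inj_on_def vec_lambda_inject)
  show "finite (int_box r :: (int ^ 'd) set)"
    unfolding eq by (intro finite_imageI finite_PiE) auto
  have "nat (int r + 1 + int r) = 2 * r + 1" by simp
  then show "card (int_box r :: (int ^ 'd) set) = (2 * r + 1) ^ CARD('d)"
    unfolding eq card_image[OF inj] by (simp add: card_PiE)
qed

lemma int_box_iff: "v \<in> int_box r \<longleftrightarrow> (\<forall>j. \<bar>v $ j\<bar> \<le> int r)"
  by (auto simp: int_box_def abs_le_iff minus_le_iff)

text \<open>The vectors are cast to the reals, where the box is convex and contains 0. Since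
  \<open>real ^ 'd\<close> has dimension \<open>CARD('d)\<close>, the scaled box bounds each integer
  coordinate by \<open>r * CARD('d)\<close>.\<close>

lemma steinitz_chain_int_box:
  fixes z :: "'b \<Rightarrow> int ^ 'd"
  assumes I: "finite I" and z: "\<And>i. i \<in> I \<Longrightarrow> z i \<in> int_box r" and sum0: "sum z I = 0"
  obtains A where "mono A" and "\<And>k. k \<le> card I \<Longrightarrow> A k \<subseteq> I"
    and "\<And>k. k \<le> card I \<Longrightarrow> card (A k) = k"
    and "\<And>k. k \<le> card I \<Longrightarrow> sum z (A k) \<in> int_box (r * CARD('d))"
proof -
  define v where "v i = (\<chi> j. real_of_int (z i $ j))" for i
  define B where "B = {u :: real ^ 'd. \<forall>j. u $ j \<in> {- real r..real r}}"
  have v_sum: "sum v J $ j = real_of_int (sum z J $ j)" for J j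
    by (simp add: v_def)
  have "convex B"
  proof -
    have "B = (\<Inter>j. (\<lambda>u. u $ j) -` {- real r..real r})" by (auto simp: B_def)
    then show ?thesis
      by (auto intro!: convex_INT convex_linear_vimage simp: linear_iff)
  qed
  moreover have "0 \<in> B" by (simp add: B_def)
  moreover have "v i \<in> B" if "i \<in> I" for i
  proof -
    have "- real r \<le> real_of_int (z i $ j) \<and> real_of_int (z i $ j) \<le> real r" for j
    proof -
      have "- int r \<le> z i $ j" "z i $ j \<le> int r"
        using z[OF that] by (auto simp: int_box_def)
      then show ?thesis by linarith
    qed
    then show ?thesis by (simp add: B_def v_def)
  qed
  moreover have "sum v I = 0"
    using sum0 by (simp add: vec_eq_iff v_sum del: sum_component)
  ultimately obtain A where A: "mono A" "\<And>k. k \<le> card I \<Longrightarrow> A k \<subseteq> I"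
      "\<And>k. k \<le> card I \<Longrightarrow> card (A k) = k"
      "\<And>k. k \<le> card I \<Longrightarrow> sum v (A k) \<in> (*\<^sub>R) (real DIM(real ^ 'd)) ` B"
    using steinitz_chain[OF I, of B v] by metis
  have "sum z (A k) \<in> int_box (r * CARD('d))" if k: "k \<le> card I" for k
  proof -
    obtain u where u: "u \<in> B" "sum v (A k) = real CARD('d) *\<^sub>R u"
      using A(4)[OF k] by auto
    have "\<bar>sum z (A k) $ j\<bar> \<le> int (r * CARD('d))" for j
    proof -
      have "real_of_int \<bar>sum z (A k) $ j\<bar> = \<bar>sum v (A k) $ j\<bar>"
        by (simp only: v_sum of_int_abs)
      also have "\<dots> = real CARD('d) * \<bar>u $ j\<bar>"
        by (simp add: u(2) abs_mult)
      also have "\<dots> \<le> real CARD('d) * real r"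
        using u(1) by (intro mult_left_mono) (auto simp: B_def abs_le_iff minus_le_iff)
      also have "\<dots> = real_of_int (int (r * CARD('d)))" by simp
      finally show ?thesis by (simp only: of_int_le_iff)
    qed
    then show ?thesis by (simp add: int_box_iff)
  qed
  then show ?thesis using that A by blast
qed

text \<open>The points dividing the segment from 0 to \<open>s\<close> into \<open>m\<close> equal
  parts are rounded down coordinatewise, and the summands are consecutive differences. Exact steps
  are at most the integer \<open>r\<close> in each coordinate, and rounding down preserves this
  bound.\<close>

lemma int_box_split:
  fixes s :: "int ^ 'd"
  assumes m: "m \<ge> 1" and s: "s \<in> int_box (m * r)"
  obtains y :: "nat \<Rightarrow> int ^ 'd" where "\<And>j. y j \<in> int_box r" and "(\<Sum>j<m. y j) = s"
proof -
  define f where "f j = (\<chi> i. (int j * s $ i) div int m)" for j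
  have "f (Suc j) - f j \<in> int_box r" for j
  proof -
    have "\<bar>(f (Suc j) - f j) $ i\<bar> \<le> int r" for i
    proof -
      have b: "\<bar>s $ i\<bar> \<le> int m * int r" using s by (simp add: int_box_iff)
      have "int (Suc j) * s $ i \<le> int j * s $ i + int r * int m"
        using b by (simp add: algebra_simps abs_le_iff)
      then have "(int (Suc j) * s $ i) div int m \<le> (int j * s $ i + int r * int m) div int m"
        using m by (intro zdiv_mono1) auto
      also have "\<dots> = (int j * s $ i) div int m + int r"
        using m by simp
      finally have upper: "(int (Suc j) * s $ i) div int m \<le> (int j * s $ i) div int m + int r" .
      have "int j * s $ i \<le> int (Suc j) * s $ i + int r * int m"
        using b by (simp add: algebra_simps abs_le_iff)
      then have "(int j * s $ i) div int m \<le> (int (Suc j) * s $ i + int r * int m) div int m"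
        using m by (intro zdiv_mono1) auto
      also have "\<dots> = (int (Suc j) * s $ i) div int m + int r"
        using m by simp
      finally show ?thesis using upper by (simp add: f_def)
    qed
    then show ?thesis by (simp only: int_box_iff) blast
  qed
  moreover have "(\<Sum>j<m. f (Suc j) - f j) = s"
    using m unfolding sum_lessThan_telescope by (simp add: f_def vec_eq_iff)
  ultimately show ?thesis by (rule that)
qed

section \<open>Pigeonhole argument on the partial sums\<close>

lemma zero_sum_subsequence:
  fixes x :: "nat \<Rightarrow> int ^ 'd"
  assumes m: "m \<ge> 1" and x: "\<And>i. i < n \<Longrightarrow> x i \<in> int_box r"
    and s: "(\<Sum>i<n. x i) \<in> int_box (m * r)"
    and n: "n + m > (m + 1) * (2 * r * CARD('d) + 1) ^ CARD('d)"
  shows "\<exists>I. I \<noteq> {} \<and> I \<subseteq> {..<n} \<and> (\<Sum>i\<in>I. x i) = 0"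
proof -
  obtain y where y: "\<And>j. y j \<in> int_box r" "(\<Sum>j<m. y j) = (\<Sum>i<n. x i)"
    using int_box_split[OF m s] by blast
  define z where "z i = (if i < n then x i else - y (i - n))" for i
  define D where "D = {n..<n + m}"
  have "(\<Sum>i<n + m. z i) = (\<Sum>i<n. z i) + (\<Sum>j<m. z (n + j))"
    by (induction m) (simp_all add: add.assoc)
  then have z0: "sum z {..<n + m} = 0"
    using y by (simp add: z_def sum_negf)
  have zb: "z i \<in> int_box r" for i
    using x y(1) by (auto simp: z_def int_box_iff)
  obtain A where A: "mono A" "\<And>k. k \<le> n + m \<Longrightarrow> A k \<subseteq> {..<n + m}"
      "\<And>k. k \<le> n + m \<Longrightarrow> card (A k) = k"
      "\<And>k. k \<le> n + m \<Longrightarrow> sum z (A k) \<in> int_box (r * CARD('d))"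
    using steinitz_chain_int_box[of "{..<n + m}" z r] zb z0 by auto
  \<comment> \<open>Recording the number of auxiliary terms costs a factor \<open>m + 1\<close>,
    against \<open>n + m\<close> partial sums. This is where the hypothesis on \<open>n + m\<close>
    comes from.\<close>
  define h where "h k = (sum z (A k), card (A k \<inter> D))" for k
  let ?T = "int_box (r * CARD('d)) \<times> {..m} :: ((int ^ 'd) \<times> nat) set"
  have "h ` {1..n + m} \<subseteq> ?T"
  proof -
    have "card (A k \<inter> D) \<le> m" for k
      using card_mono[of D "A k \<inter> D"] by (simp add: D_def)
    then show ?thesis using A(4) by (auto simp: h_def)
  qed
  moreover have "card ?T < card {1..n + m}"
    using n by (simp add: card_cartesian_product finite_card_int_box mult.commute mult.left_commute)
  ultimately have "\<not> inj_on h {1..n + m}"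
    by (intro pigeonhole) (metis (no_types, lifting) card_mono finite_card_int_box(1)
        finite_SigmaI finite_atMost le_less_trans)
  then obtain k l where kl: "k < l" "l \<le> n + m" "h k = h l"
    unfolding inj_on_def by (metis atLeastAtMost_iff linorder_neqE_nat)
  have sub: "A k \<subseteq> A l" using A(1) kl by (simp add: monoD)
  have fin: "finite (A l)" using A(2)[OF kl(2)] finite_subset by blast
  let ?I = "A l - A k"
  \<comment> \<open>The two intersections are nested and finite with equal cardinality, so the block
    \<open>A l - A k\<close> contains no auxiliary index.\<close>
  have "A k \<inter> D = A l \<inter> D"
    using kl(3) sub fin by (intro card_subset_eq) (auto simp: h_def)
  then have "?I \<subseteq> {..<n + m} - D"
    using A(2)[OF kl(2)] by blast
  also have "{..<n + m} - D = {..<n}"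
    by (auto simp: D_def)
  finally have I: "?I \<subseteq> {..<n}" .
  moreover have "?I \<noteq> {}"
    using A(3)[of k] A(3)[of l] kl sub by auto
  moreover have "sum x ?I = 0"
  proof -
    have "sum x ?I = sum z ?I" using I by (intro sum.cong) (auto simp: z_def)
    also have "\<dots> = 0" using sub fin kl(3) by (simp add: sum_diff h_def)
    finally show ?thesis .
  qed
  ultimately show ?thesis by (intro exI[of _ ?I] conjI)
qed

theorem theorem1p3:
  fixes r q n :: nat and x :: "nat \<Rightarrow> int ^ 'd"
  assumes "r \<ge> 1" and "q \<ge> 1"
    and "int n \<ge> (\<lceil>real q / real r\<rceil> + 2) * (2 * int r * int CARD('d) + 1) ^ CARD('d)"
    and "\<And>i. i < n \<Longrightarrow> x i \<in> int_box r"
    and "(\<Sum>i<n. x i) \<in> int_box q"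
  shows "\<exists>I. I \<noteq> {} \<and> I \<subset> {..<n} \<and> (\<Sum>i\<in>I. x i) = 0"
proof -
  define m where "m = nat \<lceil>real q / real r\<rceil>"
  define P where "P = (2 * r * CARD('d) + 1) ^ CARD('d)"
  have pos: "real q / real r > 0" using assms(1,2) by simp
  then have m: "m \<ge> 1" "int m = \<lceil>real q / real r\<rceil>" by (auto simp: m_def le_nat_iff)
  have P: "P \<ge> 1" by (simp add: P_def)
  have "int ((m + 2) * P) \<le> int n"
    using assms(3) by (simp add: m(2) P_def algebra_simps)
  then have n: "(m + 2) * P \<le> n" by (simp only: of_nat_le_iff)
  have qm: "q \<le> m * r"
  proof -
    have "real q / real r \<le> real m" unfolding m_def using pos by linarith
    then have "real q \<le> real (m * r)" using assms(1) by (simp add: field_simps)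
    then show ?thesis by (simp only: of_nat_le_iff)
  qed
  show ?thesis
  proof (cases "(\<Sum>i<n. x i) = 0")
    case False
    have "(\<Sum>i<n. x i) \<in> int_box (m * r)"
      using assms(5) qm unfolding int_box_iff by (meson of_nat_le_iff order_trans)
    \<comment> \<open>From \<open>n\<close> at least \<open>(m + 2) * P\<close>; strictness comes
      from \<open>m\<close> and \<open>P\<close> being positive.\<close>
    moreover have "n + m > (m + 1) * P" using n P m(1) by simp
    ultimately have "\<exists>I. I \<noteq> {} \<and> I \<subseteq> {..<n} \<and> (\<Sum>i\<in>I. x i) = 0"
      unfolding P_def by (intro zero_sum_subsequence[of m n x r] m(1) assms(4))
    then obtain I where "I \<noteq> {}" "I \<subseteq> {..<n}" "sum x I = 0"
      by blast
    \<comment> \<open>The full index set has nonzero sum, so \<open>I\<close> differs from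
      it.\<close>
    then show ?thesis using False by blast
  next
    case True
    \<comment> \<open>After one term is dropped with a single auxiliary vector, the count needed is
      \<open>n > 2 * P\<close>; this follows from \<open>3 * P \<le> n\<close> and
      \<open>P \<ge> 1\<close>.\<close>
    have "3 * P \<le> (m + 2) * P" using m(1) by (intro mult_le_mono1) simp
    then have "3 * P \<le> n" using n by (rule order_trans)
    then obtain n' where n': "n = Suc n'" "n' + 1 > (1 + 1) * P"
      using P by (cases n) auto
    \<comment> \<open>The remaining sum is the negative of one term, hence lies in the box of radius
      \<open>r\<close>, and the absent index \<open>n'\<close> makes the subsequence proper.\<close>
    have "(\<Sum>i<n'. x i) = - x n'"
      using True by (simp add: n'(1) add_eq_0_iff2)
    then have "(\<Sum>i<n'. x i) \<in> int_box (1 * r)"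
      using assms(4)[of n'] by (simp add: n'(1) int_box_iff)
    then have "\<exists>I. I \<noteq> {} \<and> I \<subseteq> {..<n'} \<and> (\<Sum>i\<in>I. x i) = 0"
      using assms(4) n' unfolding P_def by (intro zero_sum_subsequence[of 1 n' x r]) auto
    then obtain I where I: "I \<noteq> {}" "I \<subseteq> {..<n'}" "sum x I = 0"
      by blast
    then have "I \<subset> {..<n}" by (auto simp: n'(1))
    then show ?thesis using I by blast
  qed
qed

end
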